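(* Let $n\ge 2$ and let $\mathcal{A}$ be an $n\times n$ star sign pattern. Then $\mathcal{A}$ requires the nSMP if and only if both of the following hold: (i) for each symbol $\sigma\in\{0,+,-\}$, there are at most two non-centre vertices $v_i$ ($2\le i\le n$) with $\mathcal{A}_{ii}=\sigma$; and (ii) if $D(\mathcal{A})$ has two non-centre vertices with no loop, then the two $2$-cycles incident to those two vertices have the same sign.
   Context: A real $n\times n$ matrix $A$ has the non-symmetric strong multiplicity property (nSMP) if the only real $n\times n$ matrix $X$ satisfying all of (1) $A\circ X=O$ (entrywise product), (2) $AX^T-X^TA=O$, and (3) $\mathrm{tr}(X^TA^k)=0$ for all $0\le k<n$, is $X=O$ (the zero matrix). A sign pattern is an $n\times n$ matrix $\mathcal{A}$ with entries in $\{+,-,0\}$; $Q(\mathcal{A})$ is the set of real $n\times n$ matrices $A$ with $A_{ij}>0$ if $\mathcal{A}_{ij}=+$, $A_{ij}<0$ if $\mathcal{A}_{ij}=-$, and $A_{ij}=0$ if $\mathcal{A}_{ij}=0$. The pattern $\mathcal{A}$ requires a property if every $A\in Q(\mathcal{A})$ has the property. A star sign pattern is an $n\times n$ sign pattern $\mathcal{A}$ with $\mathcal{A}_{1j}\neq 0$ and $\mathcal{A}_{j1}\ne 0$ for all $2\le j\le n$, with $\mathcal{A}_{ij}=0$ for all $i\neq j$ with $i,j\ge 2$, and with arbitrary diagonal entries in $\{0,+,-\}$. The digraph $D(\mathcal{A})$ has vertices $v_1,\dots,v_n$ and an arc from $v_i$ to $v_j$, of sign $\mathcal{A}_{ij}$,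 if and only if $\mathcal{A}_{ij}\ne 0$. For a star sign pattern, $v_1$ is the centre and $v_2,\dots,v_n$ are the non-centre vertices. A vertex $v_i$ has a loop if $\mathcal{A}_{ii}\neq 0$. The $2$-cycle incident to the non-centre vertex $v_i$ is the one formed by the arcs $(v_1,v_i)$ and $(v_i,v_1)$; its sign is the product of the signs $\mathcal{A}_{1i}$ and $\mathcal{A}_{i1}$. *)

theory Defs
  imports Complex_Main "Jordan_Normal_Form.Matrix" "Graph_Theory.Pair_Digraph"
begin

(* Matrices are those of Jordan_Normal_Form, indexed from 0: the mathematical index i in {1..n}
   is represented by i - 1. In particular the centre v_1 of a star is vertex 0 and the non-centre
   vertices v_2, ..., v_n are 1, ..., n - 1. *)

definition hadamard_prod :: "real mat \<Rightarrow> real mat \<Rightarrow> real mat" where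
  "hadamard_prod A X = mat (dim_row A) (dim_col A) (\<lambda>(i, j). A $$ (i, j) * X $$ (i, j))"

definition mat_trace :: "real mat \<Rightarrow> real" where
  "mat_trace A = (\<Sum>i<dim_row A. A $$ (i, i))"

(* Meaningful only for A in carrier_mat n n. *)
definition nSMP :: "nat \<Rightarrow> real mat \<Rightarrow> bool" where
  "nSMP n A \<longleftrightarrow>
    (\<forall>X \<in> carrier_mat n n.
       hadamard_prod A X = 0\<^sub>m n n \<and>
       A * transpose_mat X - transpose_mat X * A = 0\<^sub>m n n \<and>
       (\<forall>k<n. mat_trace (transpose_mat X * (A ^\<^sub>m k)) = 0)
       \<longrightarrow> X = 0\<^sub>m n n)"

datatype sign_symbol = SPlus | SMinus | SZero

fun has_sign :: "real \<Rightarrow> sign_symbol \<Rightarrow> bool" where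
  "has_sign x SPlus \<longleftrightarrow> x > 0"
| "has_sign x SMinus \<longleftrightarrow> x < 0"
| "has_sign x SZero \<longleftrightarrow> x = 0"

fun sign_mult :: "sign_symbol \<Rightarrow> sign_symbol \<Rightarrow> sign_symbol" where
  "sign_mult SZero t = SZero"
| "sign_mult s SZero = SZero"
| "sign_mult SPlus t = t"
| "sign_mult SMinus SPlus = SMinus"
| "sign_mult SMinus SMinus = SPlus"

definition qualitative_class :: "nat \<Rightarrow> sign_symbol mat \<Rightarrow> real mat set" where
  "qualitative_class n S =
    {A \<in> carrier_mat n n. \<forall>i<n. \<forall>j<n. has_sign (A $$ (i, j)) (S $$ (i, j))}"

definition pattern_requires :: "nat \<Rightarrow> sign_symbol mat \<Rightarrow> (real mat \<Rightarrow> bool) \<Rightarrow> bool" where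
  "pattern_requires n S P \<longleftrightarrow> (\<forall>A \<in> qualitative_class n S. P A)"

definition star_sign_pattern :: "nat \<Rightarrow> sign_symbol mat \<Rightarrow> bool" where
  "star_sign_pattern n S \<longleftrightarrow>
    S \<in> carrier_mat n n \<and>
    (\<forall>j \<in> {1..<n}. S $$ (0, j) \<noteq> SZero \<and> S $$ (j, 0) \<noteq> SZero) \<and>
    (\<forall>i \<in> {1..<n}. \<forall>j \<in> {1..<n}. i \<noteq> j \<longrightarrow> S $$ (i, j) = SZero)"

(* The sign of an arc (i, j) is the pattern entry S $$ (i, j); it is not stored in the digraph. *)
definition pattern_digraph :: "nat \<Rightarrow> sign_symbol mat \<Rightarrow> nat pair_pre_digraph" where
  "pattern_digraph n S =
    \<lparr> pverts = {..<n}, parcs = {(i, j). i < n \<and> j < n \<and> S $$ (i, j) \<noteq> SZero} \<rparr>"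

definition has_loop :: "nat pair_pre_digraph \<Rightarrow> nat \<Rightarrow> bool" where
  "has_loop G i \<longleftrightarrow> (i, i) \<in> parcs G"

definition two_cycle_sign :: "sign_symbol mat \<Rightarrow> nat \<Rightarrow> sign_symbol" where
  "two_cycle_sign S i = sign_mult (S $$ (0, i)) (S $$ (i, 0))"

end

theory Submission
  imports Defs
begin

text \<open>Let \<open>A\<close> be a star matrix with centre row \<open>r\<close>, centre column \<open>c\<close> and loops \<open>d\<close>. If \<open>X\<close>
  satisfies the first two conditions of the nSMP, then \<open>X\<^sup>T = y \<oplus> Z\<close>, where \<open>Z\<close> splits into
  blocks on which \<open>d\<close> is constant and \<open>r Z = y r\<close>, \<open>Z c = y c\<close>. When no sign of loop occurs three
  times the blocks have size at most two, and the trace conditions for \<open>k \<le> 4\<close> suffice: if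
  \<open>y \<noteq> 0\<close> they force weighted moments of \<open>d\<close> to vanish, which is impossible; if \<open>y = 0\<close> the only
  possible nonzero block is a multiple of a fixed rank-one matrix on two loopless vertices, whose
  trace \<open>r\<^sub>i c\<^sub>i + r\<^sub>j c\<^sub>j\<close> is nonzero when the two 2-cycles have the same sign. Conversely, when
  (i) or (ii) fails, the \<open>\<plusminus>1\<close> matrix of the pattern has a nonzero \<open>X\<close> supported on two or three
  non-centre vertices with equal \<open>d\<close>.\<close>

declare One_nat_def [simp del] \<comment> \<open>keeps \<open>{1..<n}\<close> from being rewritten to \<open>{Suc 0..<n}\<close>\<close>

section \<open>Bordered matrices\<close>

text \<open>Block form with the centre split off. The non-centre vertices keep their indices
  \<open>1, ..., n - 1\<close>, so nothing has to be shifted, and \<open>r\<close>,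
  \<open>c\<close>, \<open>M\<close> are read only at positive indices.\<close>

definition bordered :: "nat \<Rightarrow> real \<Rightarrow> (nat \<Rightarrow> real) \<Rightarrow> (nat \<Rightarrow> real) \<Rightarrow> (nat \<Rightarrow> nat \<Rightarrow> real) \<Rightarrow> real mat"
  where "bordered n a r c M =
    mat n n (\<lambda>(i, j). if i = 0 then if j = 0 then a else r j else if j = 0 then c i else M i j)"

lemma bordered_carrier [simp]: "bordered n a r c M \<in> carrier_mat n n"
  by (simp add: bordered_def)

lemma bordered_dim [simp]:
  "dim_row (bordered n a r c M) = n" "dim_col (bordered n a r c M) = n"
  by (simp_all add: bordered_def)

lemma bordered_index:
  "\<lbrakk>i < n; j < n\<rbrakk> \<Longrightarrow> bordered n a r c M $$ (i, j) =
    (if i = 0 then if j = 0 then a else r j else if j = 0 then c i else M i j)"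
  by (simp add: bordered_def)

lemma bordered_eqI:
  assumes "a = a'"
    and "\<And>j. j \<in> {1..<n} \<Longrightarrow> r j = r' j"
    and "\<And>i. i \<in> {1..<n} \<Longrightarrow> c i = c' i"
    and "\<And>i j. \<lbrakk>i \<in> {1..<n}; j \<in> {1..<n}\<rbrakk> \<Longrightarrow> M i j = M' i j"
  shows "bordered n a r c M = bordered n a' r' c' M'"
  using assms by (intro eq_matI) (auto simp: bordered_index)

lemma bordered_eqD:
  assumes eq: "bordered n a r c M = bordered n a' r' c' M'" and n: "0 < n"
  shows "a = a'"
    and "j \<in> {1..<n} \<Longrightarrow> r j = r' j"
    and "i \<in> {1..<n} \<Longrightarrow> c i = c' i"
    and "\<lbrakk>i \<in> {1..<n}; j \<in> {1..<n}\<rbrakk> \<Longrightarrow> M i j = M' i j"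
proof -
  have *: "bordered n a r c M $$ (i, j) = bordered n a' r' c' M' $$ (i, j)" for i j
    using eq by simp
  show "a = a'" using *[of 0 0] n by (simp add: bordered_index)
  show "j \<in> {1..<n} \<Longrightarrow> r j = r' j" using *[of 0 j] n by (simp add: bordered_index)
  show "i \<in> {1..<n} \<Longrightarrow> c i = c' i" using *[of i 0] n by (simp add: bordered_index)
  show "\<lbrakk>i \<in> {1..<n}; j \<in> {1..<n}\<rbrakk> \<Longrightarrow> M i j = M' i j"
    using *[of i j] n by (simp add: bordered_index)
qed

lemma bordered_of_mat:
  assumes "A \<in> carrier_mat n n"
  shows "A = bordered n (A $$ (0, 0)) (\<lambda>j. A $$ (0, j)) (\<lambda>i. A $$ (i, 0)) (\<lambda>i j. A $$ (i, j))"
  using assms by (intro eq_matI) (auto simp: bordered_index)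

lemma sum_split_0: "0 < n \<Longrightarrow> (\<Sum>k<n. f k) = f 0 + (\<Sum>k\<in>{1..<n}. f k)"
  for f :: "nat \<Rightarrow> real"
  using sum.atLeast_Suc_lessThan[of 0 n f] by (simp add: atLeast0LessThan One_nat_def)

lemma bordered_mult:
  assumes n: "0 < n"
  shows "bordered n a r c M * bordered n a' r' c' M' =
    bordered n (a * a' + (\<Sum>k\<in>{1..<n}. r k * c' k))
      (\<lambda>j. a * r' j + (\<Sum>k\<in>{1..<n}. r k * M' k j))
      (\<lambda>i. c i * a' + (\<Sum>k\<in>{1..<n}. M i k * c' k))
      (\<lambda>i j. c i * r' j + (\<Sum>k\<in>{1..<n}. M i k * M' k j))" (is "?A * ?B = ?C")
proof (intro eq_matI)
  fix i j
  assume ij: "i < dim_row ?C" "j < dim_col ?C"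
  have "(?A * ?B) $$ (i, j) = (\<Sum>k<n. ?A $$ (i, k) * ?B $$ (k, j))"
    using ij by (simp add: times_mat_def scalar_prod_def atLeast0LessThan)
  also have "\<dots> = ?A $$ (i, 0) * ?B $$ (0, j) + (\<Sum>k\<in>{1..<n}. ?A $$ (i, k) * ?B $$ (k, j))"
    by (rule sum_split_0[OF n])
  finally show "(?A * ?B) $$ (i, j) = ?C $$ (i, j)"
    using ij n by (auto simp: bordered_index intro!: sum.cong)
qed simp_all

lemma mat_trace_bordered: "0 < n \<Longrightarrow> mat_trace (bordered n a r c M) = a + (\<Sum>i\<in>{1..<n}. M i i)"
  by (simp add: mat_trace_def sum_split_0 bordered_index)

lemma transpose_bordered: "transpose_mat (bordered n a r c M) = bordered n a c r (\<lambda>i j. M j i)"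
  by (intro eq_matI) (auto simp: bordered_index)

abbreviation diag_fun :: "(nat \<Rightarrow> real) \<Rightarrow> nat \<Rightarrow> nat \<Rightarrow> real"
  where "diag_fun d \<equiv> \<lambda>i j. if i = j then d i else 0"

lemma sum_diag_fun_right:
  "\<lbrakk>finite I; j \<in> I\<rbrakk> \<Longrightarrow> (\<Sum>k\<in>I. f k * diag_fun d k j) = f j * d j"
  by (simp add: if_distrib sum.delta cong: if_cong)

lemma sum_diag_fun_left:
  "\<lbrakk>finite I; i \<in> I\<rbrakk> \<Longrightarrow> (\<Sum>k\<in>I. diag_fun d i k * f k) = d i * f i"
  by (simp add: if_distrib[of "\<lambda>x. x * _"] sum.delta cong: if_cong)

section \<open>The centralizer of a star\<close>

text \<open>\<open>left\<close>, \<open>right\<close> and \<open>comm\<close> are the border row,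
  border column and inner block of \<open>A * Y = Y * A\<close>; \<open>loop\<close> is the diagonal
  part of the entrywise condition. The centre loop of \<open>A\<close> is set to \<open>0\<close>:
  it cancels from these equations, and the entrywise condition makes it \<open>0\<close> whenever
  \<open>y \<noteq> 0\<close>.\<close>

locale star_centralizer =
  fixes n :: nat and r c d :: "nat \<Rightarrow> real" and Z :: "nat \<Rightarrow> nat \<Rightarrow> real" and y :: real
  assumes n_pos: "0 < n"
    and c_nz: "i \<in> {1..<n} \<Longrightarrow> c i \<noteq> 0"
    and left: "j \<in> {1..<n} \<Longrightarrow> (\<Sum>k\<in>{1..<n}. r k * Z k j) = y * r j"
    and right: "i \<in> {1..<n} \<Longrightarrow> (\<Sum>k\<in>{1..<n}. Z i k * c k) = y * c i"
    and comm: "\<lbrakk>i \<in> {1..<n}; j \<in> {1..<n}\<rbrakk> \<Longrightarrow> d i * Z i j = Z i j * d j"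
    and loop: "i \<in> {1..<n} \<Longrightarrow> d i * Z i i = 0"
begin

abbreviation "I \<equiv> {1..<n}"
abbreviation "A \<equiv> bordered n 0 r c (diag_fun d)"
abbreviation "Y \<equiv> bordered n y (\<lambda>_. 0) (\<lambda>_. 0) Z"

lemma Z_eq_0: "\<lbrakk>i \<in> I; j \<in> I; d i \<noteq> d j\<rbrakk> \<Longrightarrow> Z i j = 0"
  using comm[of i j] by auto

section \<open>Traces of \<open>Y\<close> times powers of \<open>A\<close>\<close>

lemma A_sq: "A * A = bordered n (\<Sum>k\<in>I. r k * c k) (\<lambda>j. r j * d j) (\<lambda>i. d i * c i)
    (\<lambda>i j. c i * r j + diag_fun (\<lambda>i. d i * d i) i j)"
  unfolding bordered_mult[OF n_pos]
  by (rule bordered_eqI)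
    (simp_all add: sum_diag_fun_right sum_diag_fun_left del: atLeastLessThan_iff)

lemma YA: "Y * A = bordered n 0 (\<lambda>j. y * r j) (\<lambda>i. y * c i) (\<lambda>i j. Z i j * d j)"
  unfolding bordered_mult[OF n_pos]
  by (rule bordered_eqI) (simp_all add: sum_diag_fun_right right del: atLeastLessThan_iff)

lemma right_weighted:
  assumes "i \<in> I"
  shows "(\<Sum>k\<in>I. Z i k * (d k * c k)) = y * (d i * c i)"
proof -
  have "(\<Sum>k\<in>I. Z i k * (d k * c k)) = (\<Sum>k\<in>I. d i * (Z i k * c k))"
    by (intro sum.cong refl) (simp add: comm[OF assms] mult.assoc[symmetric] del: atLeastLessThan_iff)
  then show ?thesis using right[OF assms] by (simp add: sum_distrib_left[symmetric])
qed

lemma YAA: "Y * (A * A) = bordered n (y * (\<Sum>k\<in>I. r k * c k)) (\<lambda>j. y * (r j * d j))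
    (\<lambda>i. y * (d i * c i)) (\<lambda>i j. y * c i * r j + Z i j * (d j * d j))"
proof -
  have *: "(\<Sum>k\<in>I. Z i k * (c k * r j + diag_fun (\<lambda>i. d i * d i) k j)) =
      y * c i * r j + Z i j * (d j * d j)" if "i \<in> I" "j \<in> I" for i j
  proof -
    have "(\<Sum>k\<in>I. Z i k * (c k * r j + diag_fun (\<lambda>i. d i * d i) k j)) =
        (\<Sum>k\<in>I. Z i k * c k) * r j + (\<Sum>k\<in>I. Z i k * diag_fun (\<lambda>i. d i * d i) k j)"
      by (simp only: distrib_left sum.distrib sum_distrib_right mult.assoc)
    then show ?thesis
      by (simp only: right[OF that(1)] sum_diag_fun_right[OF finite_atLeastLessThan that(2)])
  qed
  then show ?thesis
    unfolding A_sq unfolding bordered_mult[OF n_pos]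
    by (intro bordered_eqI)
      (simp_all only: * right_weighted mult_zero_left mult_zero_right
        sum.neutral_const add_0_left add_0_right)
qed

text \<open>Summing over the row index first lets \<open>left\<close> replace \<open>Z\<close> by
  the scalar \<open>y\<close>; this removes the off-diagonal entries of \<open>Z\<close> from the
  traces.\<close>

lemma double_sum:
  "(\<Sum>i\<in>I. \<Sum>j\<in>I. Z i j * w j * (c j * r i)) = y * (\<Sum>j\<in>I. r j * c j * w j)"
proof -
  have "(\<Sum>i\<in>I. \<Sum>j\<in>I. Z i j * w j * (c j * r i)) = (\<Sum>j\<in>I. (\<Sum>i\<in>I. r i * Z i j) * (w j * c j))"
    by (subst sum.swap) (simp only: sum_distrib_right, simp only: ac_simps)
  also have "\<dots> = (\<Sum>j\<in>I. y * r j * (w j * c j))"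
    by (intro sum.cong) (simp_all add: left del: atLeastLessThan_iff)
  finally show ?thesis by (simp add: sum_distrib_left ac_simps)
qed

lemma loop2: "i \<in> I \<Longrightarrow> d i * (d i * Z i i) = 0"
  using loop[of i] by auto

text \<open>This trace and those for exponents 3 and 4 equal \<open>y\<close> times the difference
  of the trace of \<open>A^k\<close> and the sum of the \<open>d i ^ k\<close>. Closed walks through
  the centre are weighted by \<open>y\<close>; those that only repeat a loop carry the factor
  \<open>d i * Z i i\<close>, which is \<open>0\<close>.\<close>

lemma trace_Y_A2: "mat_trace (Y * (A * A)) = 2 * y * (\<Sum>k\<in>I. r k * c k)"
  unfolding YAA mat_trace_bordered[OF n_pos]
  by (simp add: sum.distrib loop2 sum_distrib_left[symmetric] ac_simps del: atLeastLessThan_iff)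

lemma sum_Z_diag:
  assumes "i \<in> I"
  shows "(\<Sum>j\<in>I. Z i j * w j * (c j * r i + diag_fun (\<lambda>i. d i * d i) j i)) =
    (\<Sum>j\<in>I. Z i j * w j * (c j * r i))"
proof -
  have "(\<Sum>j\<in>I. Z i j * w j * diag_fun (\<lambda>i. d i * d i) j i) = 0"
    unfolding sum_diag_fun_right[OF finite_atLeastLessThan assms] using loop[OF assms] by auto
  then show ?thesis by (simp only: distrib_left sum.distrib add_0_right)
qed

lemma trace_Y_A3: "mat_trace (Y * A * (A * A)) = 3 * y * (\<Sum>k\<in>I. r k * c k * d k)"
proof -
  let ?Q = "\<Sum>k\<in>I. r k * c k * d k"
  have "mat_trace (Y * A * (A * A)) =
    (\<Sum>k\<in>I. y * r k * (d k * c k)) + (\<Sum>i\<in>I. y * c i * (r i * d i)) +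
    (\<Sum>i\<in>I. \<Sum>j\<in>I. Z i j * d j * (c j * r i))"
    unfolding YA unfolding A_sq unfolding bordered_mult[OF n_pos] mat_trace_bordered[OF n_pos]
    by (simp add: sum_Z_diag sum.distrib del: atLeastLessThan_iff)
  also have "\<dots> = y * ?Q + y * ?Q + y * ?Q"
    unfolding double_sum by (simp add: sum_distrib_left ac_simps)
  finally show ?thesis by simp
qed

lemma trace_Y_A4: "mat_trace (Y * (A * A) * (A * A)) =
    2 * y * (\<Sum>k\<in>I. r k * c k)\<^sup>2 + 4 * y * (\<Sum>k\<in>I. r k * c k * (d k)\<^sup>2)"
proof -
  let ?P = "\<Sum>k\<in>I. r k * c k" and ?R = "\<Sum>k\<in>I. r k * c k * (d k)\<^sup>2"
  have *: "(\<Sum>j\<in>I. (y * c i * r j + Z i j * (d j * d j)) * (c j * r i + diag_fun (\<lambda>i. d i * d i) j i)) =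
      y * (r i * c i) * ?P + y * (r i * c i * (d i)\<^sup>2) + (\<Sum>j\<in>I. Z i j * (d j * d j) * (c j * r i))"
    (is "?L = _") if "i \<in> I" for i
  proof -
    have "?L = (\<Sum>j\<in>I. y * c i * r j * (c j * r i)) +
        (\<Sum>j\<in>I. y * c i * r j * diag_fun (\<lambda>i. d i * d i) j i) +
        (\<Sum>j\<in>I. Z i j * (d j * d j) * (c j * r i + diag_fun (\<lambda>i. d i * d i) j i))"
      by (simp only: distrib_left distrib_right sum.distrib add.assoc)
    also have "\<dots> = (\<Sum>j\<in>I. y * c i * r j * (c j * r i)) + y * c i * r i * (d i * d i) +
        (\<Sum>j\<in>I. Z i j * (d j * d j) * (c j * r i))"
      unfolding sum_diag_fun_right[OF finite_atLeastLessThan that] sum_Z_diag[OF that] ..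
    finally show ?thesis
      by (simp add: sum_distrib_left power2_eq_square ac_simps)
  qed
  have "mat_trace (Y * (A * A) * (A * A)) =
    y * ?P * ?P + (\<Sum>k\<in>I. y * (r k * d k) * (d k * c k)) +
    (\<Sum>i\<in>I. y * (d i * c i) * (r i * d i) + (y * (r i * c i) * ?P + y * (r i * c i * (d i)\<^sup>2)
      + (\<Sum>j\<in>I. Z i j * (d j * d j) * (c j * r i))))"
    unfolding YAA unfolding A_sq unfolding bordered_mult[OF n_pos] mat_trace_bordered[OF n_pos]
    using * by (simp add: mult.assoc del: atLeastLessThan_iff)
  also have "\<dots> = y * ?P * ?P + y * ?R + (y * ?R + (y * ?P * ?P + y * ?R + y * ?R))"
    unfolding sum.distrib double_sum
    by (simp add: sum_distrib_left sum_distrib_right power2_eq_square ac_simps)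
  finally show ?thesis by (simp add: power2_eq_square)
qed

text \<open>\<open>Z\<close> has no entry between vertices with different \<open>d\<close>, so the
  equation can be read on any \<open>J\<close> that contains the class of \<open>j\<close>.\<close>

lemma left_support:
  assumes "J \<subseteq> I" and "\<And>k. \<lbrakk>k \<in> I; d k = d j\<rbrakk> \<Longrightarrow> k \<in> J" and "j \<in> I"
  shows "(\<Sum>k\<in>J. r k * Z k j) = y * r j"
  unfolding left[OF assms(3), symmetric]
  using assms Z_eq_0 by (intro sum.mono_neutral_left) (auto simp del: atLeastLessThan_iff)

lemma right_support:
  assumes "J \<subseteq> I" and "\<And>k. \<lbrakk>k \<in> I; d k = d i\<rbrakk> \<Longrightarrow> k \<in> J" and "i \<in> I"
  shows "(\<Sum>k\<in>J. Z i k * c k) = y * c i"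
  unfolding right[OF assms(3), symmetric]
  using assms Z_eq_0[OF assms(3)]
  by (intro sum.mono_neutral_left) (force simp del: atLeastLessThan_iff)+

lemma singleton_class:
  assumes "i \<in> I" and "\<And>k. \<lbrakk>k \<in> I; d k = d i\<rbrakk> \<Longrightarrow> k = i"
  shows "Z i i = y"
  using right_support[of "{i}" i] assms c_nz[of i] by auto

lemma pair_class:
  assumes "i \<in> I" "j \<in> I" "i \<noteq> j" and "\<And>k. \<lbrakk>k \<in> I; d k = d i\<rbrakk> \<Longrightarrow> k = i \<or> k = j"
  shows "Z i i * c i + Z i j * c j = y * c i"
  using right_support[of "{i, j}" i] assms by auto

end

text \<open>\<open>two\<close> and \<open>same_sign\<close> are (i) and (ii) read off the real
  entries. In \<open>two\<close>, \<open>j\<close> may coincide with \<open>i\<close> or have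
  another sign, so later arguments test whether it is a genuine partner. The guards
  \<open>2 < n\<close> to \<open>4 < n\<close> reflect that only powers below \<open>n\<close> are
  available.\<close>

locale star_centralizer_traces = star_centralizer +
  assumes two: "i \<in> {1..<n} \<Longrightarrow>
      \<exists>j\<in>{1..<n}. \<forall>k\<in>{1..<n}. sgn (d k) = sgn (d i) \<longrightarrow> k = i \<or> k = j"
    and same_sign: "\<lbrakk>i \<in> {1..<n}; j \<in> {1..<n}; i \<noteq> j; d i = 0; d j = 0\<rbrakk> \<Longrightarrow>
      r i * c i * (r j * c j) > 0"
    and trace0: "y + (\<Sum>i\<in>{1..<n}. Z i i) = 0"
    and trace2: "2 < n \<Longrightarrow> mat_trace (Y * (A * A)) = 0"
    and trace3: "3 < n \<Longrightarrow> mat_trace (Y * A * (A * A)) = 0"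
    and trace4: "4 < n \<Longrightarrow> mat_trace (Y * (A * A) * (A * A)) = 0"
begin

section \<open>Vanishing of \<open>y\<close> and \<open>Z\<close>\<close>

lemma pair_sum_nz:
  assumes "i \<in> I" "j \<in> I" "i \<noteq> j" "d i = 0" "d j = 0"
  shows "r i * c i + r j * c j \<noteq> 0"
proof
  assume "r i * c i + r j * c j = 0"
  then have "r j * c j = - (r i * c i)" by simp
  with same_sign[OF assms] have "- ((r i * c i) * (r i * c i)) > 0" by simp
  then show False using zero_le_square[of "r i * c i"] by linarith
qed

text \<open>By \<open>loop\<close>, a vertex with \<open>d k \<noteq> 0\<close> has
  \<open>Z k k = 0\<close>, so only loopless vertices contribute to \<open>trace0\<close>.\<close>

lemma sum_diag_support:
  assumes "J \<subseteq> I" and "\<And>k. \<lbrakk>k \<in> I; d k = 0\<rbrakk> \<Longrightarrow> k \<in> J"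
  shows "y + (\<Sum>k\<in>J. Z k k) = 0"
proof -
  have "(\<Sum>k\<in>J. Z k k) = (\<Sum>k\<in>I. Z k k)"
    using assms loop by (intro sum.mono_neutral_left) (auto simp del: atLeastLessThan_iff)
  then show ?thesis using trace0 by simp
qed

text \<open>If \<open>y \<noteq> 0\<close>, there are two loopless vertices, and the nonzero \<open>d\<^sub>i\<close> take at most one
  positive and one negative value. The moments \<open>\<Sum> r\<^sub>k c\<^sub>k d\<^sub>k^m\<close> then vanish for
  \<open>m = 0, 1, 2\<close>, which kills the weight of each of these values and leaves the loopless weight,
  which is nonzero.\<close>

lemma y_eq_0: "y = 0"
proof (rule ccontr)
  assume y: "y \<noteq> 0"
  \<comment> \<open>A vertex alone with its nonzero value would have
    \<open>Z i i = y \<noteq> 0\<close>, against \<open>loop\<close>.\<close>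
  have partner: "\<exists>j\<in>I. j \<noteq> i \<and> d j = d i" if "i \<in> I" "d i \<noteq> 0" for i
    using singleton_class[OF that(1)] loop[OF that(1)] that y by (metis mult_eq_0_iff)
  \<comment> \<open>By \<open>two\<close>, \<open>i\<close> and its partner exhaust their sign
    class.\<close>
  have same_value: "d k = d i" if "i \<in> I" "k \<in> I" "sgn (d k) = sgn (d i)" "d i \<noteq> 0" for i k
    using two[OF that(1)] partner[OF that(1,4)] that(2,3) by metis
  \<comment> \<open>With no loopless vertex \<open>trace0\<close> gives \<open>y = 0\<close>; with
    exactly one, \<open>Z i i = y\<close> and it gives \<open>2 * y = 0\<close>.\<close>
  obtain i j where ij: "i \<in> I" "j \<in> I" "i \<noteq> j" "d i = 0" "d j = 0"
    and zero: "\<And>k. \<lbrakk>k \<in> I; d k = 0\<rbrakk> \<Longrightarrow> k = i \<or> k = j"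
  proof -
    obtain i where i: "i \<in> I" "d i = 0"
    proof (cases "\<exists>i\<in>I. d i = 0")
      case False
      then have "y + (\<Sum>k\<in>{}. Z k k) = 0" by (intro sum_diag_support) blast+
      then show ?thesis using y by simp
    qed (use that in blast)
    obtain j where j: "j \<in> I" "\<And>k. \<lbrakk>k \<in> I; d k = 0\<rbrakk> \<Longrightarrow> k = i \<or> k = j"
      using two[OF i(1)] i(2) by (metis sgn_0)
    have "j \<noteq> i \<and> d j = 0"
    proof (rule ccontr)
      assume "\<not> (j \<noteq> i \<and> d j = 0)"
      then have only: "\<And>k. \<lbrakk>k \<in> I; d k = 0\<rbrakk> \<Longrightarrow> k = i" using j by blast
      then have "Z i i = y" using singleton_class[OF i(1)] i(2) by simp
      moreover have "y + Z i i = 0" using sum_diag_support[of "{i}"] only i(1) by auto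
      ultimately show False using y by simp
    qed
    with i j show ?thesis by (intro that[of i j]) auto
  qed
  define p where "p k = r k * c k" for k
  define P N where "P = (\<Sum>k\<in>I. if d k > 0 then p k else 0)"
    and "N = (\<Sum>k\<in>I. if d k < 0 then p k else 0)"
  \<comment> \<open>Two distinct non-centre vertices force \<open>2 < n\<close>, which makes
    \<open>trace2\<close> available.\<close>
  have "card {i, j} \<le> card I" using ij by (intro card_mono) auto
  then have "2 < n" using ij by simp
  then have m0: "(\<Sum>k\<in>I. p k) = 0"
    using trace2 y by (simp add: trace_Y_A2 p_def)
  have "P = 0 \<and> N = 0"
  proof (cases "\<forall>k\<in>I. d k = 0")
    case True
    then show ?thesis by (simp add: P_def N_def del: atLeastLessThan_iff)
  next
    case False
    then obtain k where k: "k \<in> I" "d k \<noteq> 0" by blast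
    obtain l where l: "l \<in> I" "l \<noteq> k" "d l = d k" using partner[OF k] by blast
    \<comment> \<open>Two loopless and two looped vertices force \<open>4 < n\<close>, so
      \<open>trace3\<close> and \<open>trace4\<close> become available as well.\<close>
    have "card {i, j, k, l} \<le> card I" using ij k l by (intro card_mono) auto
    moreover have "card {i, j, k, l} = 4" using ij k l by (auto simp: card_insert_if)
    ultimately have n: "4 < n" by simp
    have m1: "(\<Sum>k\<in>I. p k * d k) = 0"
      using trace3 n y by (simp add: trace_Y_A3 p_def)
    have m2: "(\<Sum>k\<in>I. p k * (d k)\<^sup>2) = 0"
      using trace4 n y m0 by (simp add: trace_Y_A4 p_def)
    \<comment> \<open>Without a positive \<open>d k\<close>, \<open>a\<close> is an arbitrary
      positive number, here 1; likewise -1 for \<open>b\<close>. What matters below is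
      \<open>b < 0 < a\<close>.\<close>
    obtain a where a: "a > 0" "\<And>k. \<lbrakk>k \<in> I; d k > 0\<rbrakk> \<Longrightarrow> d k = a"
    proof (cases "\<exists>k\<in>I. d k > 0")
      case True
      then obtain k where k: "k \<in> I" "d k > 0" by blast
      show ?thesis
      proof (rule that[OF k(2)])
        show "d l = d k" if "l \<in> I" "d l > 0" for l
          by (rule same_value) (use k that in simp_all)
      qed
    qed (use that[of 1] in auto)
    obtain b where b: "b < 0" "\<And>k. \<lbrakk>k \<in> I; d k < 0\<rbrakk> \<Longrightarrow> d k = b"
    proof (cases "\<exists>k\<in>I. d k < 0")
      case True
      then obtain k where k: "k \<in> I" "d k < 0" by blast
      show ?thesis
      proof (rule that[OF k(2)])
        show "d l = d k" if "l \<in> I" "d l < 0" for l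
          by (rule same_value) (use k that in simp_all)
      qed
    qed (use that[of "-1"] in auto)
    have split: "p k * f (d k) =
        f a * (if d k > 0 then p k else 0) + f b * (if d k < 0 then p k else 0)"
      if "k \<in> I" "f 0 = 0" for k and f :: "real \<Rightarrow> real"
      using a(2)[OF that(1)] b(2)[OF that(1)] that(2)
      by (cases "d k" "0 :: real" rule: linorder_cases) auto
    \<comment> \<open>\<open>f 0 = 0\<close> drops the loopless vertices and leaves one term for
      each of the two nonzero values.\<close>
    have moment: "(\<Sum>k\<in>I. p k * f (d k)) = f a * P + f b * N"
      if "f 0 = 0" for f :: "real \<Rightarrow> real"
      unfolding P_def N_def sum_distrib_left sum.distrib[symmetric]
      by (intro sum.cong refl split that)
    have e1: "a * P + b * N = 0" using moment[of "\<lambda>x. x"] m1 by simp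
    have e2: "a\<^sup>2 * P + b\<^sup>2 * N = 0" using moment[of "\<lambda>x. x\<^sup>2"] m2 by simp
    \<comment> \<open>This combination eliminates \<open>N\<close>; the factor
      \<open>a * (a - b)\<close> is nonzero because \<open>b < 0 < a\<close>.\<close>
    have "a * (a - b) * P = (a\<^sup>2 * P + b\<^sup>2 * N) - b * (a * P + b * N)"
      by (simp add: algebra_simps power2_eq_square)
    then have "P = 0" using e1 e2 a b by simp
    then show ?thesis using e1 b by simp
  qed
  moreover have "(\<Sum>k\<in>I. p k) = P + N + (\<Sum>k\<in>I. if d k = 0 then p k else 0)"
    unfolding P_def N_def sum.distrib[symmetric] by (intro sum.cong) auto
  moreover have "(\<Sum>k\<in>I. if d k = 0 then p k else 0) = (\<Sum>k\<in>{i, j}. p k)"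
    using ij zero by (intro sum.mono_neutral_cong_right) (auto simp del: atLeastLessThan_iff)
  ultimately show False using m0 ij pair_sum_nz[OF ij] by (simp add: p_def)
qed

text \<open>The critical case is a pair of loopless vertices. \<open>trace0\<close> gives
  \<open>Z j j = - Z i i\<close>, and the equations for \<open>c\<close> and \<open>r\<close> then
  yield \<open>Z i i * (r i * c i + r j * c j) = 0\<close>, where (ii) makes the second factor
  nonzero.\<close>

lemma Z_diag_eq_0:
  assumes i: "i \<in> I"
  shows "Z i i = 0"
proof (cases "d i = 0")
  case False
  then show ?thesis using loop[OF i] by simp
next
  case True
  obtain j where j: "j \<in> I" "\<And>k. \<lbrakk>k \<in> I; d k = 0\<rbrakk> \<Longrightarrow> k = i \<or> k = j"
    using two[OF i] True by (metis sgn_0)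
  show ?thesis
  proof (cases "j \<noteq> i \<and> d j = 0")
    case False
    then have "\<And>k. \<lbrakk>k \<in> I; d k = 0\<rbrakk> \<Longrightarrow> k = i" using j by blast
    then show ?thesis using singleton_class[OF i] True y_eq_0 by simp
  next
    case ji: True
    have "(\<Sum>k\<in>{i, j}. Z k k) = 0"
      using sum_diag_support[of "{i, j}"] i j y_eq_0 by auto
    then have e1: "Z j j = - Z i i" using ji by simp
    have e2: "Z i i * c i + Z i j * c j = 0"
      using pair_class[of i j] i j ji True y_eq_0 by simp
    have "(\<Sum>k\<in>{i, j}. r k * Z k j) = 0"
      using left_support[of "{i, j}" j] i j ji y_eq_0 by auto
    then have e3: "r i * Z i j = r j * Z i i" using ji e1 by simp
    have "Z i i * (r i * c i + r j * c j) = r i * (Z i i * c i) + (r j * Z i i) * c j"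
      by (simp add: algebra_simps)
    also have "\<dots> = r i * (Z i i * c i + Z i j * c j)"
      unfolding e3[symmetric] by (simp add: algebra_simps)
    finally have "Z i i * (r i * c i + r j * c j) = 0" using e2 by simp
    then show ?thesis using pair_sum_nz[of i j] i j ji True by simp
  qed
qed

text \<open>For \<open>i \<noteq> k\<close> with equal \<open>d\<close>, the class is
  \<open>{i, k}\<close>; once \<open>Z i i\<close> and \<open>y\<close> vanish, its row equation
  reduces to \<open>Z i k * c k = 0\<close>.\<close>

lemma Z_eq_0_everywhere:
  assumes i: "i \<in> I" and k: "k \<in> I"
  shows "Z i k = 0"
proof (cases "i = k \<or> d i \<noteq> d k")
  case True
  then show ?thesis using Z_diag_eq_0 Z_eq_0 assms by blast
next
  case False
  then have "k' = i \<or> k' = k" if "k' \<in> I" "d k' = d i" for k'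
    using two[OF i] k that by metis
  then have "Z i i * c i + Z i k * c k = y * c i"
    using pair_class[OF i k] False by blast
  then show ?thesis using Z_diag_eq_0[OF i] y_eq_0 c_nz[OF k] by simp
qed

end

section \<open>Sign patterns\<close>

lemma sgn_eq_iff_has_sign:
  "\<lbrakk>has_sign x s; has_sign x' s'\<rbrakk> \<Longrightarrow> sgn x = sgn x' \<longleftrightarrow> s = s'"
  by (cases s; cases s') auto

lemma has_sign_mult: "\<lbrakk>has_sign x s; has_sign x' s'\<rbrakk> \<Longrightarrow> has_sign (x * x') (sign_mult s s')"
  by (cases s; cases s') (auto simp: mult_pos_pos mult_pos_neg mult_neg_pos mult_neg_neg)

lemma has_sign_nz: "\<lbrakk>has_sign x s; s \<noteq> SZero\<rbrakk> \<Longrightarrow> x \<noteq> 0"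
  by (cases s) auto

lemma has_loop_pattern_digraph:
  "i < n \<Longrightarrow> has_loop (pattern_digraph n S) i \<longleftrightarrow> S $$ (i, i) \<noteq> SZero"
  by (simp add: has_loop_def pattern_digraph_def)

lemma card_le_2_obtain:
  assumes "finite K" "card K \<le> 2" "i \<in> K"
  obtains j where "j \<in> K" "\<And>k. k \<in> K \<Longrightarrow> k = i \<or> k = j"
proof -
  have "card (K - {i}) \<le> 1" using assms by simp
  then consider "K - {i} = {}" | j where "K - {i} = {j}"
    using assms(1) by (metis card_1_singletonE card_0_eq finite_Diff le_Suc_eq One_nat_def le_0_eq)
  then show ?thesis
  proof cases
    case 1
    then show ?thesis using that[of i] assms(3) by blast
  next
    case 2
    then show ?thesis using that[of j] by blast
  qed
qed

lemma star_matrix_bordered: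
  assumes "star_sign_pattern n S" "A \<in> qualitative_class n S"
  shows "A = bordered n (A $$ (0, 0)) (\<lambda>j. A $$ (0, j)) (\<lambda>i. A $$ (i, 0))
    (diag_fun (\<lambda>i. A $$ (i, i)))"
proof -
  have "A $$ (i, j) = 0" if "i \<in> {1..<n}" "j \<in> {1..<n}" "i \<noteq> j" for i j
  proof -
    have "has_sign (A $$ (i, j)) (S $$ (i, j))"
      using assms(2) that by (simp add: qualitative_class_def)
    moreover have "S $$ (i, j) = SZero"
      using assms(1) that by (simp add: star_sign_pattern_def)
    ultimately show ?thesis by simp
  qed
  moreover have "A \<in> carrier_mat n n" using assms(2) by (simp add: qualitative_class_def)
  ultimately show ?thesis
    by (subst bordered_of_mat[of A n], simp) (intro bordered_eqI, auto)
qed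

section \<open>Sufficiency of (i) and (ii)\<close>

lemma nSMP_if_conditions:
  assumes n: "n \<ge> 2" and star: "star_sign_pattern n S"
    and card: "\<And>\<sigma>. card {i \<in> {1..<n}. S $$ (i, i) = \<sigma>} \<le> 2"
    and cycles: "\<And>i j. \<lbrakk>i \<in> {1..<n}; j \<in> {1..<n}; i \<noteq> j; S $$ (i, i) = SZero;
      S $$ (j, j) = SZero\<rbrakk> \<Longrightarrow> two_cycle_sign S i = two_cycle_sign S j"
    and A: "A \<in> qualitative_class n S"
  shows "nSMP n A"
  unfolding nSMP_def
proof (intro ballI impI, elim conjE)
  fix X :: "real mat"
  assume X: "X \<in> carrier_mat n n" and had: "hadamard_prod A X = 0\<^sub>m n n"
    and com: "A * transpose_mat X - transpose_mat X * A = 0\<^sub>m n n"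
    and tr: "\<forall>k<n. mat_trace (transpose_mat X * (A ^\<^sub>m k)) = 0"
  have n0: "0 < n" using n by simp
  have Ac: "A \<in> carrier_mat n n" using A by (simp add: qualitative_class_def)
  have sign: "has_sign (A $$ (i, j)) (S $$ (i, j))" if "i < n" "j < n" for i j
    using A that by (simp add: qualitative_class_def)
  have had': "A $$ (i, j) * X $$ (i, j) = 0" if "i < n" "j < n" for i j
    using arg_cong[OF had, of "\<lambda>M. M $$ (i, j)"] Ac that by (simp add: hadamard_prod_def)
  define a r c d where "a = A $$ (0, 0)" and "r = (\<lambda>j. A $$ (0, j))"
    and "c = (\<lambda>i. A $$ (i, 0))" and "d = (\<lambda>i. A $$ (i, i))"
  define y Z where "y = X $$ (0, 0)" and "Z = (\<lambda>i j. X $$ (j, i))"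
  let ?Y = "bordered n y (\<lambda>_. 0) (\<lambda>_. 0) Z"
  have A_eq: "A = bordered n a r c (diag_fun d)"
    unfolding a_def r_def c_def d_def by (rule star_matrix_bordered[OF star A])
  have nz: "A $$ (0, i) \<noteq> 0" "A $$ (i, 0) \<noteq> 0" if "i \<in> {1..<n}" for i
    using star that sign[of 0 i] sign[of i 0] n0
    by (auto simp: star_sign_pattern_def dest: has_sign_nz)
  \<comment> \<open>The border of \<open>A\<close> has no zero entry, so the entrywise condition
    clears the border of \<open>X\<close>.\<close>
  have "X = bordered n y (\<lambda>_. 0) (\<lambda>_. 0) (\<lambda>i j. Z j i)"
    unfolding y_def Z_def
  proof (subst bordered_of_mat[OF X], rule bordered_eqI)
    show "X $$ (0, j) = 0" if "j \<in> {1..<n}" for j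
      using had'[of 0 j] nz[OF that] that by simp
    show "X $$ (j, 0) = 0" if "j \<in> {1..<n}" for j
      using had'[of j 0] nz[OF that] that by simp
  qed simp_all
  then have Xt: "transpose_mat X = ?Y" and X_eq: "X = bordered n y (\<lambda>_. 0) (\<lambda>_. 0) (\<lambda>i j. Z j i)"
    by (simp_all add: transpose_bordered)
  have "A * ?Y = ?Y * A"
  proof (rule eq_matI)
    fix i j assume "i < dim_row (?Y * A)" "j < dim_col (?Y * A)"
    then show "(A * ?Y) $$ (i, j) = (?Y * A) $$ (i, j)"
      using arg_cong[OF com, of "\<lambda>M. M $$ (i, j)"] Ac unfolding Xt by simp
  qed (use Ac in simp_all)
  note eqs = bordered_eqD[OF this[unfolded A_eq bordered_mult[OF n0]] n0]
  interpret star_centralizer n r c d Z y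
  proof
    show "(\<Sum>k\<in>{1..<n}. r k * Z k j) = y * r j" if "j \<in> {1..<n}" for j
      using eqs(2)[OF that] by simp
    show "(\<Sum>k\<in>{1..<n}. Z i k * c k) = y * c i" if "i \<in> {1..<n}" for i
      using eqs(3)[OF that] by (simp add: mult.commute)
    show "d i * Z i j = Z i j * d j" if "i \<in> {1..<n}" "j \<in> {1..<n}" for i j
      using eqs(4)[OF that] sum_diag_fun_left[of "{1..<n}" i d "\<lambda>k. Z k j"]
        sum_diag_fun_right[of "{1..<n}" j "Z i" d] that
      by (simp del: atLeastLessThan_iff)
    show "d i * Z i i = 0" if "i \<in> {1..<n}" for i
      using had'[of i i] that by (simp add: d_def Z_def)
  qed (use n0 nz in \<open>auto simp: r_def c_def\<close>)
  have Yc: "?Y \<in> carrier_mat n n" by simp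
  have AAc: "A * A \<in> carrier_mat n n" using Ac by simp
  have pow_Suc: "A ^\<^sub>m Suc k = A ^\<^sub>m k * A" for k by simp
  have A2: "A ^\<^sub>m 2 = A * A"
    using Ac by (simp add: numeral_2_eq_2)
  have A3: "A ^\<^sub>m 3 = A * (A * A)"
    using pow_Suc[of 2] unfolding A2 assoc_mult_mat[OF Ac Ac Ac] by simp
  have A4: "A ^\<^sub>m 4 = A * A * (A * A)"
    using pow_Suc[of 3]
    unfolding A3 assoc_mult_mat[OF Ac AAc Ac] assoc_mult_mat[OF Ac Ac AAc]
      assoc_mult_mat[OF Ac Ac Ac]
    by simp
  \<comment> \<open>The powers are bracketed to match the products whose traces are known.\<close>
  have powers: "?Y * A ^\<^sub>m 2 = ?Y * (A * A)" "?Y * A ^\<^sub>m 3 = ?Y * A * (A * A)"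
    "?Y * A ^\<^sub>m 4 = ?Y * (A * A) * (A * A)"
    unfolding A2 A3 A4 assoc_mult_mat[OF Yc Ac AAc] assoc_mult_mat[OF Yc AAc AAc] by (rule refl)+
  note t = tr[unfolded Xt, rule_format, of 2, unfolded powers]
    tr[unfolded Xt, rule_format, of 3, unfolded powers]
    tr[unfolded Xt, rule_format, of 4, unfolded powers]
  \<comment> \<open>If \<open>y \<noteq> 0\<close>, the centre loop is \<open>0\<close> and
    \<open>A\<close> is the matrix of the locale. If \<open>y = 0\<close>, the three traces below
    vanish by their formulas, whatever the centre loop is.\<close>
  have A0: "y \<noteq> 0 \<Longrightarrow> A = bordered n 0 r c (diag_fun d)"
    using had'[of 0 0] n0 by (subst A_eq) (simp add: y_def a_def)
  let ?A = "bordered n 0 r c (diag_fun d)"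
  have t2: "mat_trace (?Y * (?A * ?A)) = 0" if "2 < n"
  proof (cases "y = 0")
    case True
    show ?thesis unfolding trace_Y_A2 by (simp add: True)
  next
    case False
    show ?thesis using t(1)[OF that] unfolding A0[OF False] .
  qed
  have t3: "mat_trace (?Y * ?A * (?A * ?A)) = 0" if "3 < n"
  proof (cases "y = 0")
    case True
    show ?thesis unfolding trace_Y_A3 by (simp add: True)
  next
    case False
    show ?thesis using t(2)[OF that] unfolding A0[OF False] .
  qed
  have t4: "mat_trace (?Y * (?A * ?A) * (?A * ?A)) = 0" if "4 < n"
  proof (cases "y = 0")
    case True
    show ?thesis unfolding trace_Y_A4 by (simp add: True)
  next
    case False
    show ?thesis using t(3)[OF that] unfolding A0[OF False] .
  qed
  interpret star_centralizer_traces n r c d Z y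
  proof
    show "\<exists>j\<in>{1..<n}. \<forall>k\<in>{1..<n}. sgn (d k) = sgn (d i) \<longrightarrow> k = i \<or> k = j"
      if i: "i \<in> {1..<n}" for i
    proof -
      let ?K = "{k \<in> {1..<n}. S $$ (k, k) = S $$ (i, i)}"
      have "finite ?K" "i \<in> ?K" using i by simp_all
      then obtain j where j: "j \<in> ?K" "\<And>k. k \<in> ?K \<Longrightarrow> k = i \<or> k = j"
        by (rule card_le_2_obtain[OF _ card]) blast
      have eq: "sgn (d k) = sgn (d i) \<longleftrightarrow> S $$ (k, k) = S $$ (i, i)" if "k \<in> {1..<n}" for k
        unfolding d_def using that i by (intro sgn_eq_iff_has_sign sign) auto
      show ?thesis
      proof (intro bexI[of _ j] ballI impI)
        fix k assume "k \<in> {1..<n}" "sgn (d k) = sgn (d i)"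
        then show "k = i \<or> k = j" using j(2)[of k] eq[of k] by simp
      qed (use j(1) in simp)
    qed
    show "0 < r i * c i * (r j * c j)"
      if ij: "i \<in> {1..<n}" "j \<in> {1..<n}" "i \<noteq> j" "d i = 0" "d j = 0" for i j
    proof -
      have s: "has_sign (r k * c k) (two_cycle_sign S k)" if "k \<in> {1..<n}" for k
        unfolding two_cycle_sign_def r_def c_def using that n0 by (intro has_sign_mult sign) auto
      have "S $$ (i, i) = SZero" "S $$ (j, j) = SZero"
        using sign[of i i] sign[of j j] ij unfolding d_def by (auto dest: has_sign_nz)
      then have "two_cycle_sign S i = two_cycle_sign S j" using cycles ij by blast
      moreover have "r i * c i \<noteq> 0" using nz[OF ij(1)] by (simp add: r_def c_def)
      ultimately show ?thesis
        using s[OF ij(1)] s[OF ij(2)]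
        by (cases "two_cycle_sign S i") (simp_all add: mult_neg_neg)
    qed
    show "y + (\<Sum>i\<in>{1..<n}. Z i i) = 0"
      using tr[unfolded Xt, rule_format, of 0] Ac n0 right_mult_one_mat[OF Yc]
      by (simp add: mat_trace_bordered)
  qed (fact t2 t3 t4)+
  show "X = 0\<^sub>m n n"
    unfolding X_eq using y_eq_0 Z_eq_0_everywhere
    by (intro eq_matI) (auto simp: bordered_index)
qed

section \<open>Necessity\<close>

fun sign_value :: "sign_symbol \<Rightarrow> real" where
  "sign_value SPlus = 1"
| "sign_value SMinus = - 1"
| "sign_value SZero = 0"

lemma has_sign_sign_value [simp]: "has_sign (sign_value s) s"
  by (cases s) auto

lemma sign_value_mult: "sign_value (sign_mult s t) = sign_value s * sign_value t"
  by (cases s; cases t) auto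

lemma sign_value_eq_0_iff [simp]: "sign_value s = 0 \<longleftrightarrow> s = SZero"
  by (cases s) auto

definition sign_mat :: "nat \<Rightarrow> sign_symbol mat \<Rightarrow> real mat" where
  "sign_mat n S = mat n n (\<lambda>(i, j). sign_value (S $$ (i, j)))"

lemma sign_mat_in_class: "sign_mat n S \<in> qualitative_class n S"
  by (simp add: sign_mat_def qualitative_class_def)

text \<open>The matrix \<open>diag(c) M diag(r)\<close> on the non-centre vertices is annihilated by \<open>r\<close> on the
  left and by \<open>c\<close> on the right as soon as \<open>M\<close> is annihilated by \<open>p\<close> on both sides.\<close>

lemma not_nSMP_bordered:
  fixes r c :: "nat \<Rightarrow> real" and M :: "nat \<Rightarrow> nat \<Rightarrow> real"
  defines "p \<equiv> \<lambda>k. r k * c k"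
  assumes n: "0 < n"
    and left: "\<And>j. j \<in> {1..<n} \<Longrightarrow> (\<Sum>k\<in>{1..<n}. p k * M k j) = 0"
    and right: "\<And>i. i \<in> {1..<n} \<Longrightarrow> (\<Sum>k\<in>{1..<n}. M i k * p k) = 0"
    and support: "\<And>i j. \<lbrakk>i \<in> {1..<n}; j \<in> {1..<n}; M i j \<noteq> 0\<rbrakk> \<Longrightarrow> d i = \<delta> \<and> d j = \<delta>"
    and loop: "\<And>i. i \<in> {1..<n} \<Longrightarrow> d i * M i i = 0"
    and trace: "(\<Sum>i\<in>{1..<n}. p i * M i i) = 0"
    and nonzero: "i \<in> {1..<n}" "j \<in> {1..<n}" "M i j \<noteq> 0" "c i \<noteq> 0" "r j \<noteq> 0"
  shows "\<not> nSMP n (bordered n a r c (diag_fun d))"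
proof
  let ?A = "bordered n a r c (diag_fun d)"
  define Z where "Z = (\<lambda>i j. c i * M i j * r j)"
  let ?Y = "bordered n 0 (\<lambda>_. 0) (\<lambda>_. 0) Z"
  let ?X = "transpose_mat ?Y"
  assume smp: "nSMP n ?A"
  have dZ: "d i * Z i j = \<delta> * Z i j" "Z i j * d j = \<delta> * Z i j"
    if "i \<in> {1..<n}" "j \<in> {1..<n}" for i j
    using support[OF that] by (cases "M i j = 0"; simp add: Z_def)+
  have rZ: "(\<Sum>k\<in>{1..<n}. r k * Z k j) = 0" if "j \<in> {1..<n}" for j
  proof -
    have "(\<Sum>k\<in>{1..<n}. r k * Z k j) = (\<Sum>k\<in>{1..<n}. p k * M k j) * r j"
      unfolding Z_def p_def sum_distrib_right by (simp add: ac_simps)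
    then show ?thesis using left[OF that] by simp
  qed
  have Zc: "(\<Sum>k\<in>{1..<n}. Z i k * c k) = 0" if "i \<in> {1..<n}" for i
  proof -
    have "(\<Sum>k\<in>{1..<n}. Z i k * c k) = c i * (\<Sum>k\<in>{1..<n}. M i k * p k)"
      unfolding Z_def p_def sum_distrib_left by (simp add: ac_simps)
    then show ?thesis using right[OF that] by simp
  qed
  have smult: "\<delta> \<cdot>\<^sub>m ?Y = bordered n 0 (\<lambda>_. 0) (\<lambda>_. 0) (\<lambda>i j. \<delta> * Z i j)"
    by (intro eq_matI) (auto simp: bordered_index)
  \<comment> \<open>All loops on the support of \<open>Z\<close> equal \<open>\<delta>\<close>, and
    \<open>r\<close> and \<open>c\<close> annihilate \<open>Z\<close>, so \<open>Y\<close> is an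
    eigenmatrix of \<open>A\<close> from both sides.\<close>
  have AY: "?A * ?Y = \<delta> \<cdot>\<^sub>m ?Y"
    unfolding smult bordered_mult[OF n]
    by (rule bordered_eqI) (simp_all add: rZ sum_diag_fun_left[where d = d] dZ del: atLeastLessThan_iff)
  have YA: "?Y * ?A = \<delta> \<cdot>\<^sub>m ?Y"
    unfolding smult bordered_mult[OF n]
    by (rule bordered_eqI) (simp_all add: Zc sum_diag_fun_right dZ del: atLeastLessThan_iff)
  have Yc: "?Y \<in> carrier_mat n n" and Ac: "?A \<in> carrier_mat n n" by simp_all
  \<comment> \<open>Every trace condition thus becomes a multiple of the one for
    \<open>k = 0\<close>.\<close>
  have pow: "?Y * ?A ^\<^sub>m k = \<delta> ^ k \<cdot>\<^sub>m ?Y" for k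
  proof (induction k)
    case 0
    show ?case by (intro eq_matI) (auto simp: right_mult_one_mat[OF Yc])
  next
    case (Suc k)
    have "?Y * ?A ^\<^sub>m Suc k = (?Y * ?A ^\<^sub>m k) * ?A"
      using assoc_mult_mat[OF Yc pow_carrier_mat[OF Ac] Ac] by simp
    also have "\<dots> = \<delta> ^ k \<cdot>\<^sub>m (\<delta> \<cdot>\<^sub>m ?Y)"
      unfolding Suc using YA mult_smult_assoc_mat[OF Yc Ac] by simp
    also have "\<dots> = \<delta> ^ Suc k \<cdot>\<^sub>m ?Y" by (intro eq_matI) auto
    finally show ?case .
  qed
  have "mat_trace ?Y = 0"
    using trace unfolding mat_trace_bordered[OF n] by (simp add: Z_def p_def ac_simps)
  moreover have "mat_trace (\<alpha> \<cdot>\<^sub>m ?Y) = \<alpha> * mat_trace ?Y" for \<alpha>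
    by (simp add: mat_trace_def sum_distrib_left)
  ultimately have "\<forall>k<n. mat_trace (transpose_mat ?X * ?A ^\<^sub>m k) = 0"
    by (simp add: pow)
  moreover have "hadamard_prod ?A ?X = 0\<^sub>m n n"
    using loop by (intro eq_matI) (auto simp: hadamard_prod_def bordered_index Z_def One_nat_def Suc_le_eq)
  moreover have "?A * transpose_mat ?X - transpose_mat ?X * ?A = 0\<^sub>m n n"
    unfolding transpose_transpose AY YA by (intro eq_matI) auto
  moreover have "?X \<in> carrier_mat n n" by simp
  ultimately have "?X = 0\<^sub>m n n" using smp unfolding nSMP_def by blast
  then have "?X $$ (j, i) = 0" using nonzero by simp
  then show False using nonzero by (simp add: bordered_index Z_def)
qed

text \<open>Applied to the \<open>\<plusminus>1\<close> matrix of the pattern, the previous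
  construction has weights \<open>r k * c k\<close> equal to the 2-cycle signs. As \<open>M\<close>
  lives on \<open>J\<close>, all sums shrink to \<open>J\<close>, and two or three vertices remain
  to be checked.\<close>

lemma not_requires_nSMP:
  fixes S :: "sign_symbol mat" and M :: "nat \<Rightarrow> nat \<Rightarrow> real"
  defines "p \<equiv> \<lambda>k. sign_value (two_cycle_sign S k)"
  assumes n: "0 < n" and star: "star_sign_pattern n S"
    and J: "J \<subseteq> {1..<n}" "\<And>i. i \<in> J \<Longrightarrow> S $$ (i, i) = \<sigma>"
    and support: "\<And>i j. M i j \<noteq> 0 \<Longrightarrow> i \<in> J \<and> j \<in> J"
    and left: "\<And>j. j \<in> J \<Longrightarrow> (\<Sum>k\<in>J. p k * M k j) = 0"
    and right: "\<And>i. i \<in> J \<Longrightarrow> (\<Sum>k\<in>J. M i k * p k) = 0"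
    and loop: "\<And>i. i \<in> J \<Longrightarrow> \<sigma> = SZero \<or> M i i = 0"
    and trace: "(\<Sum>i\<in>J. p i * M i i) = 0"
    and nonzero: "M i j \<noteq> 0"
  shows "\<not> pattern_requires n S (nSMP n)"
proof -
  let ?r = "\<lambda>j. sign_mat n S $$ (0, j)" and ?c = "\<lambda>i. sign_mat n S $$ (i, 0)"
  let ?d = "\<lambda>i. sign_mat n S $$ (i, i)"
  have p: "?r k * ?c k = p k" if "k \<in> {1..<n}" for k
    using that n by (simp add: p_def two_cycle_sign_def sign_value_mult sign_mat_def)
  have extend: "(\<Sum>k\<in>{1..<n}. f k) = (\<Sum>k\<in>J. g k)"
    if "\<And>k. k \<in> {1..<n} \<Longrightarrow> f k = g k" "\<And>k. k \<notin> J \<Longrightarrow> g k = 0" for f g :: "nat \<Rightarrow> real"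
    using J(1) that by (intro sum.mono_neutral_cong_right) (auto simp: subset_iff)
  have out: "M i j = 0" if "i \<notin> J \<or> j \<notin> J" for i j
    using support that by blast
  have "\<not> nSMP n (bordered n (sign_mat n S $$ (0, 0)) ?r ?c (diag_fun ?d))"
  proof (rule not_nSMP_bordered[where M = M and \<delta> = "sign_value \<sigma>" and i = i and j = j])
    fix j
    have "(\<Sum>k\<in>{1..<n}. ?r k * ?c k * M k j) = (\<Sum>k\<in>J. p k * M k j)"
      by (rule extend) (simp_all add: p out del: atLeastLessThan_iff)
    then show "(\<Sum>k\<in>{1..<n}. ?r k * ?c k * M k j) = 0"
      by (cases "j \<in> J") (simp_all add: left out)
  next
    fix i
    have "(\<Sum>k\<in>{1..<n}. M i k * (?r k * ?c k)) = (\<Sum>k\<in>J. M i k * p k)"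
      by (rule extend) (simp_all add: p out del: atLeastLessThan_iff)
    then show "(\<Sum>k\<in>{1..<n}. M i k * (?r k * ?c k)) = 0"
      by (cases "i \<in> J") (simp_all add: right out)
  next
    have "(\<Sum>i\<in>{1..<n}. ?r i * ?c i * M i i) = (\<Sum>i\<in>J. p i * M i i)"
      by (rule extend) (simp_all add: p out del: atLeastLessThan_iff)
    then show "(\<Sum>i\<in>{1..<n}. ?r i * ?c i * M i i) = 0"
      using trace by simp
  next
    show "?d i = sign_value \<sigma> \<and> ?d j = sign_value \<sigma>"
      if "i \<in> {1..<n}" "j \<in> {1..<n}" "M i j \<noteq> 0" for i j
      using support[OF that(3)] that J(2) by (simp add: sign_mat_def)
  next
    show "?d i * M i i = 0" if "i \<in> {1..<n}" for i
      using out[of i i] J(2)[of i] loop[of i] that by (cases "i \<in> J") (auto simp: sign_mat_def)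
  next
    have ij: "i \<in> J" "j \<in> J" using support[OF nonzero] by simp_all
    then show "i \<in> {1..<n}" "j \<in> {1..<n}" using J(1) by blast+
    then show "?c i \<noteq> 0" "?r j \<noteq> 0"
      using star n by (auto simp: sign_mat_def star_sign_pattern_def)
  qed (use n nonzero in auto)
  then have "\<not> nSMP n (sign_mat n S)"
    unfolding star_matrix_bordered[OF star sign_mat_in_class, symmetric] .
  then show ?thesis
    using sign_mat_in_class unfolding pattern_requires_def by blast
qed

text \<open>Three vertices with equal loop symbol: on them take the cross product matrix of \<open>p\<close>.\<close>

lemma not_requires_if_three_equal:
  assumes n: "0 < n" and star: "star_sign_pattern n S"
    and card: "\<not> card {i \<in> {1..<n}. S $$ (i, i) = \<sigma>} \<le> 2"
  shows "\<not> pattern_requires n S (nSMP n)"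
proof -
  have "3 \<le> card {i \<in> {1..<n}. S $$ (i, i) = \<sigma>}" using card by simp
  from obtain_subset_with_card_n[OF this]
  obtain J where J: "J \<subseteq> {i \<in> {1..<n}. S $$ (i, i) = \<sigma>}" "card J = 3"
    by blast
  obtain u v w where uvw: "J = {u, v, w}" "u \<noteq> v" "u \<noteq> w" "v \<noteq> w"
    using J(2) by (auto simp: card_3_iff)
  define p where "p k = sign_value (two_cycle_sign S k)" for k
  \<comment> \<open>\<open>M\<close> is skew-symmetric, so its diagonal is zero and the loop and
    trace conditions hold for every \<open>\<sigma>\<close>; it annihilates \<open>p\<close> because
    the cross product of \<open>p\<close> with itself is zero.\<close>
  define M where "M i j =
    (if i = u \<and> j = v then p w else if i = v \<and> j = u then - p w
     else if i = v \<and> j = w then p u else if i = w \<and> j = v then - p u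
     else if i = w \<and> j = u then p v else if i = u \<and> j = w then - p v else 0)" for i j
  have "S $$ (0, w) \<noteq> SZero" "S $$ (w, 0) \<noteq> SZero"
    using star J(1) uvw(1) by (auto simp: star_sign_pattern_def)
  then have "p w \<noteq> 0"
    by (simp add: p_def two_cycle_sign_def sign_value_mult del: sign_value_eq_0_iff) simp
  then have "M u v \<noteq> 0" by (simp add: M_def)
  then show ?thesis
    using J(1) uvw
    by (intro not_requires_nSMP[OF n star, of J \<sigma> M u v])
      (auto simp: M_def p_def split: if_splits)
qed

text \<open>Two loopless vertices with \<open>p\<^sub>u = - p\<^sub>v\<close>: take \<open>w w\<^sup>T\<close> with \<open>w\<close> orthogonal to \<open>p\<close>.\<close>

lemma not_requires_if_opposite_cycles:
  assumes n: "0 < n" and star: "star_sign_pattern n S"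
    and uv: "u \<in> {1..<n}" "v \<in> {1..<n}" "u \<noteq> v" "S $$ (u, u) = SZero" "S $$ (v, v) = SZero"
    and cycles: "two_cycle_sign S u \<noteq> two_cycle_sign S v"
  shows "\<not> pattern_requires n S (nSMP n)"
proof -
  define p where "p k = sign_value (two_cycle_sign S k)" for k
  define w where "w k = (if k = u then p v else if k = v then - p u else 0)" for k
  have nz: "p k \<noteq> 0" if "k \<in> {1..<n}" for k
    using star that unfolding p_def two_cycle_sign_def sign_value_mult
    by (auto simp: star_sign_pattern_def)
  \<comment> \<open>Both values are \<open>\<plusminus>1\<close>, so different means opposite. The
    trace is \<open>p u * p v * (p u + p v)\<close>, which vanishes for this reason.\<close>
  have opp: "p u = - p v"
    using cycles nz[OF uv(1)] nz[OF uv(2)] unfolding p_def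
    by (cases "two_cycle_sign S u"; cases "two_cycle_sign S v") auto
  have "w u * w u \<noteq> 0" using nz uv by (simp add: w_def)
  then show ?thesis
    using uv opp
    by (intro not_requires_nSMP[OF n star, of "{u, v}" SZero "\<lambda>i j. w i * w j" u u])
      (auto simp: w_def p_def algebra_simps split: if_splits)
qed

theorem theorem3p6:
  fixes n :: nat and S :: "sign_symbol mat"
  assumes "n \<ge> 2"
    and "star_sign_pattern n S"
  shows "pattern_requires n S (nSMP n) \<longleftrightarrow>
    (\<forall>\<sigma>. card {i \<in> {1..<n}. S $$ (i, i) = \<sigma>} \<le> 2) \<and>
    (\<forall>i \<in> {1..<n}. \<forall>j \<in> {1..<n}.
       i \<noteq> j \<and> \<not> has_loop (pattern_digraph n S) i \<and> \<not> has_loop (pattern_digraph n S) j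
       \<longrightarrow> two_cycle_sign S i = two_cycle_sign S j)"
proof
  assume req: "pattern_requires n S (nSMP n)"
  have n: "0 < n" using assms(1) by simp
  show "(\<forall>\<sigma>. card {i \<in> {1..<n}. S $$ (i, i) = \<sigma>} \<le> 2) \<and>
    (\<forall>i \<in> {1..<n}. \<forall>j \<in> {1..<n}.
       i \<noteq> j \<and> \<not> has_loop (pattern_digraph n S) i \<and> \<not> has_loop (pattern_digraph n S) j
       \<longrightarrow> two_cycle_sign S i = two_cycle_sign S j)"
  proof (intro conjI allI ballI impI)
    show "card {i \<in> {1..<n}. S $$ (i, i) = \<sigma>} \<le> 2" for \<sigma>
      using not_requires_if_three_equal[OF n assms(2)] req by blast
    show "two_cycle_sign S i = two_cycle_sign S j"
      if "i \<in> {1..<n}" "j \<in> {1..<n}"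
        "i \<noteq> j \<and> \<not> has_loop (pattern_digraph n S) i \<and> \<not> has_loop (pattern_digraph n S) j" for i j
      using not_requires_if_opposite_cycles[OF n assms(2) that(1,2)] that req
      by (auto simp: has_loop_pattern_digraph)
  qed
next
  assume conds: "(\<forall>\<sigma>. card {i \<in> {1..<n}. S $$ (i, i) = \<sigma>} \<le> 2) \<and>
    (\<forall>i \<in> {1..<n}. \<forall>j \<in> {1..<n}.
       i \<noteq> j \<and> \<not> has_loop (pattern_digraph n S) i \<and> \<not> has_loop (pattern_digraph n S) j
       \<longrightarrow> two_cycle_sign S i = two_cycle_sign S j)"
  show "pattern_requires n S (nSMP n)"
    unfolding pattern_requires_def
  proof (intro ballI nSMP_if_conditions[OF assms])
    show "card {i \<in> {1..<n}. S $$ (i, i) = \<sigma>} \<le> 2" for \<sigma>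
      using conds by blast
    show "two_cycle_sign S i = two_cycle_sign S j"
      if "i \<in> {1..<n}" "j \<in> {1..<n}" "i \<noteq> j" "S $$ (i, i) = SZero" "S $$ (j, j) = SZero" for i j
    proof -
      have "\<not> has_loop (pattern_digraph n S) i" "\<not> has_loop (pattern_digraph n S) j"
        using that by (simp_all add: has_loop_pattern_digraph)
      then show ?thesis using conds that(1-3) by blast
    qed
  qed
qed

end
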